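(* Let $n\ge 1$ and let $D_n \subset \mathbb{R}^{n(n+1)/2}$ be the set of all vectors $(s_{i,j})_{0 \le i<j \le n}$ for which there exists a non-degenerate simplex with vertices $v_0,\dots,v_n \in \mathbb{E}^n$ such that $s_{i,j} = d(v_i,v_j)^2$ for all $0\le i<j\le n$. Then $D_n$ (the set of non-degenerate simplices parametrized by the squares of the edge-lengths) is a convex cone.
   Context: $\mathbb{E}^n$ is $n$-dimensional Euclidean space with distance $d$. A simplex with vertices $v_0,\dots,v_n\in\mathbb{E}^n$ is non-degenerate if $v_0,\dots,v_n$ are affinely independent. A convex cone is a subset of a real vector space that is convex and closed under multiplication by positive real scalars. *)

theory Defs
  imports "HOL-Analysis.Analysis"
begin

text \<open>The dimension \<open>n \<ge> 1\<close> is \<^term>\<open>CARD('n)\<close>, for an arbitrary finite index type \<open>'n\<close>, and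
  \<open>n\<close>-dimensional Euclidean space is \<^typ>\<open>real^'n\<close>.  The coordinates \<open>s\<^sub>i\<^sub>,\<^sub>j\<close> are indexed by the
  following type, so that the parameter space is the real vector space \<open>real^('n edge)\<close>.\<close>

typedef ('n::finite) edge = "{(i::nat, j::nat). i < j \<and> j \<le> CARD('n)}"
  by (rule exI[of _ "(0, 1)"]) (simp add: Suc_leI)

instance edge :: (finite) finite
proof
  have "{(i::nat, j::nat). i < j \<and> j \<le> CARD('a)} \<subseteq> {..CARD('a)} \<times> {..CARD('a)}"
    by auto
  then have "finite {(i::nat, j::nat). i < j \<and> j \<le> CARD('a)}"
    by (rule finite_subset) simp
  then show "finite (UNIV :: 'a edge set)"
    unfolding type_definition.univ[OF type_definition_edge] by (rule finite_imageI)
qed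

lemma card_edge: "CARD('n::finite edge) = CARD('n) * (CARD('n) + 1) div 2"
proof -
  have "{(i::nat, j::nat). i < j \<and> j \<le> m} = (\<lambda>(j, i). (i, j)) ` (SIGMA j:{..m}. {..<j})" for m
    by auto
  moreover have "inj_on (\<lambda>(j::nat, i::nat). (i, j)) A" for A
    by (auto simp: inj_on_def)
  ultimately have "card {(i::nat, j::nat). i < j \<and> j \<le> m} = card (SIGMA j:{..m}. {..<j})" for m
    by (simp add: card_image)
  also have "card (SIGMA j:{..m}. {..<j}) = (\<Sum>j\<in>{0..m}. j)" for m
    by (simp add: atLeast0AtMost)
  also have "(\<Sum>j\<in>{0..m}. j) = m * (m + 1) div 2" for m :: nat
    using gauss_sum_nat[of m] by simp
  finally show ?thesis
    using type_definition.card[OF type_definition_edge[where 'n = 'n]] by simp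
qed

text \<open>\<^const>\<open>affine_dependent\<close> speaks about sets, so injectivity is needed to express affine
  independence of the family \<open>v\<^sub>0, \<dots>, v\<^sub>n\<close>.\<close>

definition nondegenerate_simplex :: "nat \<Rightarrow> (nat \<Rightarrow> 'a::real_vector) \<Rightarrow> bool" where
  "nondegenerate_simplex n v \<longleftrightarrow> inj_on v {..n} \<and> \<not> affine_dependent (v ` {..n})"

definition simplex_sq_lengths :: "(real^('n::finite edge)) set" where
  "simplex_sq_lengths = {s. \<exists>v :: nat \<Rightarrow> real^'n.
     nondegenerate_simplex CARD('n) v \<and>
     (\<forall>i j. i < j \<and> j \<le> CARD('n) \<longrightarrow> s $ Abs_edge (i, j) = (dist (v i) (v j))\<^sup>2)}"

text \<open>The library's \<^const>\<open>cone\<close>, \<^const>\<open>conic\<close> and \<^const>\<open>convex_cone\<close> require closure under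
  multiplication by \<open>0\<close> as well; here only positive scalars are admitted.\<close>

definition pos_convex_cone :: "'a::real_vector set \<Rightarrow> bool" where
  "pos_convex_cone S \<longleftrightarrow> convex S \<and> (\<forall>x\<in>S. \<forall>c>0. c *\<^sub>R x \<in> S)"

end

theory Submission
  imports Defs
begin

text \<open>Squared lengths add up under the Pythagorean theorem. If \<open>v\<close> and \<open>w\<close> are simplices in
  \<open>\<real>\<^sup>n\<close> with squared edge lengths \<open>s\<close> and \<open>t\<close>, then for \<open>a, b \<ge> 0\<close> the points
  \<open>(sqrt a v\<^sub>i, sqrt b w\<^sub>i)\<close> of \<open>\<real>\<^sup>n \<times> \<real>\<^sup>n\<close> have squared mutual distances \<open>a s + b t\<close>. They are
  affinely independent as soon as \<open>a > 0\<close>, because an affine dependence among them projects to one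
  among the points \<open>v\<^sub>i\<close> (lemma \<open>nondegenerate_simplex_Pair\<close>). Being \<open>n + 1\<close> points, they lie in
  an affine subspace of dimension at most \<open>n\<close>, which an isometry carries into \<open>\<real>\<^sup>n\<close> (lemma
  \<open>simplex_sq_lengths_ambient\<close>). So \<open>a s + b t\<close> is realised in \<open>\<real>\<^sup>n\<close>: \<open>b = 0\<close> gives the closure
  under positive scalars, and \<open>a + b = 1\<close> gives convexity, where the case \<open>a = 0\<close> is trivial
  because the combination is then \<open>t\<close> itself.\<close>

text \<open>Coefficients indexed by vertex numbers, rather than by the points themselves, capture
  injectivity and affine independence in one condition: two equal points \<open>v\<^sub>i = v\<^sub>j\<close> are the
  dependence with coefficients \<open>1\<close> and \<open>-1\<close>. In this form a dependence
  of the images under a linear map is compared with one of the points by linearity alone.\<close>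

lemma nondegenerate_simplex_iff_coeffs:
  "nondegenerate_simplex n v \<longleftrightarrow>
    (\<forall>c. (\<Sum>i\<le>n. c i) = 0 \<and> (\<Sum>i\<le>n. c i *\<^sub>R v i) = 0 \<longrightarrow> (\<forall>i\<le>n. c i = 0))"
    (is "_ \<longleftrightarrow> ?R")
proof
  assume nd: "nondegenerate_simplex n v"
  then have inj: "inj_on v {..n}" and ind: "\<not> affine_dependent (v ` {..n})"
    by (auto simp: nondegenerate_simplex_def)
  show ?R
  proof (intro allI impI)
    fix c i assume c: "(\<Sum>i\<le>n. c i) = 0 \<and> (\<Sum>i\<le>n. c i *\<^sub>R v i) = 0" and i: "i \<le> n"
    define u where "u = (\<lambda>x. c (the_inv_into {..n} v x))"
    have u: "u (v j) = c j" if "j \<le> n" for j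
      using inj that by (simp add: u_def the_inv_into_f_f)
    have "sum u (v ` {..n}) = 0" "(\<Sum>x\<in>v ` {..n}. u x *\<^sub>R x) = 0"
      using c by (simp_all add: sum.reindex[OF inj] u)
    then have "u (v i) = 0"
      using ind i unfolding affine_dependent_explicit_finite[OF finite_imageI[OF finite_atMost]]
      by blast
    then show "c i = 0" using u i by simp
  qed
next
  assume R: ?R
  have inj: "inj_on v {..n}"
  proof (rule inj_onI, rule ccontr)
    fix i j assume ij: "i \<in> {..n}" "j \<in> {..n}" "v i = v j" "i \<noteq> j"
    define c :: "nat \<Rightarrow> real" where "c k = of_bool (k = i) - of_bool (k = j)" for k
    have "(\<Sum>k\<le>n. c k) = 0"
      using ij by (simp add: c_def sum_subtractf of_bool_def)
    moreover have "c k *\<^sub>R v k = (if k = i then v k else 0) - (if k = j then v k else 0)" for k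
      by (simp add: c_def)
    then have "(\<Sum>k\<le>n. c k *\<^sub>R v k) = 0"
      using ij by (simp add: sum_subtractf)
    ultimately have "c i = 0" using R[rule_format, of c i] ij(1) by simp
    then show False using ij by (simp add: c_def)
  qed
  have "\<not> affine_dependent (v ` {..n})"
  proof
    assume "affine_dependent (v ` {..n})"
    then obtain u where u: "sum u (v ` {..n}) = 0" "(\<Sum>x\<in>v ` {..n}. u x *\<^sub>R x) = 0"
        "\<exists>x\<in>v ` {..n}. u x \<noteq> 0"
      by (auto simp: affine_dependent_explicit_finite)
    have "u (v i) = 0" if "i \<le> n" for i
      using R[rule_format, of "\<lambda>i. u (v i)", OF _ that] u(1,2) by (simp add: sum.reindex[OF inj])
    then show False using u(3) by auto
  qed
  with inj show "nondegenerate_simplex n v" by (simp add: nondegenerate_simplex_def)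
qed

lemma nondegenerate_simplex_coeffs_zero:
  assumes "nondegenerate_simplex n v"
    and "(\<Sum>i\<le>n. c i) = 0" "(\<Sum>i\<le>n. c i *\<^sub>R v i) = 0" and "i \<le> n"
  shows "c i = 0"
  using assms(1)[unfolded nondegenerate_simplex_iff_coeffs, rule_format, of c i] assms(2-4)
  by simp

lemma nondegenerate_simplex_Pair:
  assumes "nondegenerate_simplex n v" and "a \<noteq> 0"
  shows "nondegenerate_simplex n (\<lambda>i. (a *\<^sub>R v i, w i))"
  unfolding nondegenerate_simplex_iff_coeffs
proof (intro allI impI)
  fix c i
  assume c: "(\<Sum>i\<le>n. c i) = 0 \<and> (\<Sum>i\<le>n. c i *\<^sub>R (a *\<^sub>R v i, w i)) = 0" and "i \<le> n"
  then have "fst (\<Sum>i\<le>n. c i *\<^sub>R (a *\<^sub>R v i, w i)) = 0" by simp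
  then have "a *\<^sub>R (\<Sum>i\<le>n. c i *\<^sub>R v i) = 0"
    by (simp add: fst_sum scaleR_sum_right mult.commute)
  then have "(\<Sum>i\<le>n. c i *\<^sub>R v i) = 0" using \<open>a \<noteq> 0\<close> by simp
  then show "c i = 0"
    using nondegenerate_simplex_coeffs_zero[where c = c, OF assms(1) _ _ \<open>i \<le> n\<close>] c by simp
qed

text \<open>The dimension of the ambient space does not matter: the edge vectors out of vertex \<open>0\<close> span
  a subspace of dimension at most \<open>n\<close>, so there is a linear map into \<open>\<real>\<^sup>n\<close> which preserves the norm
  on that subspace. It preserves all edge lengths, and it is injective there, so it creates
  no new affine dependence.\<close>

lemma simplex_sq_lengths_ambient:
  fixes p :: "nat \<Rightarrow> 'a::euclidean_space" and s :: "real^('n::finite edge)"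
  assumes nd: "nondegenerate_simplex CARD('n) p"
    and s: "\<And>i j. i < j \<Longrightarrow> j \<le> CARD('n) \<Longrightarrow> s $ Abs_edge (i, j) = (dist (p i) (p j))\<^sup>2"
  shows "s \<in> simplex_sq_lengths"
proof -
  let ?n = "CARD('n)"
  define S where "S = span ((\<lambda>i. p i - p 0) ` {1..?n})"
  have subS: "subspace S" by (simp add: S_def)
  have "dim S \<le> card ((\<lambda>i. p i - p 0) ` {1..?n})"
    unfolding S_def dim_span by (rule dim_le_card') simp
  also have "\<dots> \<le> dim (UNIV :: (real^'n) set)"
    using card_image_le[of "{1..?n}" "\<lambda>i. p i - p 0"] by simp
  finally have "dim S \<le> dim (UNIV :: (real^'n) set)" .
  then obtain f :: "'a \<Rightarrow> real^'n" where lin: "linear f"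
    and norm: "\<And>x. x \<in> S \<Longrightarrow> norm (f x) = norm x"
    using isometry_subset_subspace[OF subS, of "UNIV :: (real^'n) set"] by auto
  have inS: "p i - p 0 \<in> S" if "i \<le> ?n" for i
  proof (cases "i = 0")
    case True
    then show ?thesis using subS by (simp add: subspace_0)
  next
    case False
    then show ?thesis using that by (auto simp: S_def intro!: span_base)
  qed
  define q where "q i = f (p i - p 0)" for i
  have dist: "dist (q i) (q j) = dist (p i) (p j)" if "i \<le> ?n" "j \<le> ?n" for i j
  proof -
    have "(p i - p 0) - (p j - p 0) \<in> S"
      using subS inS that by (blast intro: subspace_diff)
    then have "norm (f ((p i - p 0) - (p j - p 0))) = norm ((p i - p 0) - (p j - p 0))"
      by (rule norm)
    then show ?thesis
      by (simp add: q_def dist_norm linear_diff[OF lin])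
  qed
  have "nondegenerate_simplex ?n q"
    unfolding nondegenerate_simplex_iff_coeffs
  proof (intro allI impI)
    fix c i
    assume c: "(\<Sum>i\<le>?n. c i) = 0 \<and> (\<Sum>i\<le>?n. c i *\<^sub>R q i) = 0" and i: "i \<le> ?n"
    let ?x = "\<Sum>i\<le>?n. c i *\<^sub>R (p i - p 0)"
    have "f ?x = (\<Sum>i\<le>?n. c i *\<^sub>R q i)"
      by (simp add: q_def linear_sum[OF lin] linear_scale[OF lin])
    moreover have "?x \<in> S"
      using subS inS by (auto intro!: subspace_sum subspace_scale)
    ultimately have "?x = 0" using c norm[of ?x] by simp
    (* The base point cancels because the coefficients sum to zero. *)
    then have "(\<Sum>i\<le>?n. c i *\<^sub>R p i) = 0"
      using c by (simp add: scaleR_diff_right sum_subtractf flip: scaleR_sum_left)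
    then show "c i = 0" using nondegenerate_simplex_coeffs_zero[where c = c, OF nd _ _ i] c by simp
  qed
  moreover have "s $ Abs_edge (i, j) = (dist (q i) (q j))\<^sup>2" if "i < j" "j \<le> ?n" for i j
    using s[OF that] dist[of i j] that by simp
  ultimately show ?thesis
    unfolding simplex_sq_lengths_def by blast
qed

lemma simplex_sq_lengths_combination:
  fixes s t :: "real^('n::finite edge)"
  assumes "s \<in> simplex_sq_lengths" "t \<in> simplex_sq_lengths" and a: "a > 0" and b: "b \<ge> 0"
  shows "a *\<^sub>R s + b *\<^sub>R t \<in> simplex_sq_lengths"
proof -
  obtain v w :: "nat \<Rightarrow> real^'n" where v: "nondegenerate_simplex CARD('n) v"
    and s: "\<And>i j. i < j \<Longrightarrow> j \<le> CARD('n) \<Longrightarrow> s $ Abs_edge (i, j) = (dist (v i) (v j))\<^sup>2"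
    and t: "\<And>i j. i < j \<Longrightarrow> j \<le> CARD('n) \<Longrightarrow> t $ Abs_edge (i, j) = (dist (w i) (w j))\<^sup>2"
    using assms(1,2) by (auto simp: simplex_sq_lengths_def)
  have "nondegenerate_simplex CARD('n) (\<lambda>i. (sqrt a *\<^sub>R v i, sqrt b *\<^sub>R w i))"
    using a by (simp add: nondegenerate_simplex_Pair[OF v])
  then show ?thesis
  proof (rule simplex_sq_lengths_ambient)
    fix i j :: nat assume "i < j" "j \<le> CARD('n)"
    note st = s[OF this] t[OF this]
    have "dist (sqrt c *\<^sub>R x) (sqrt c *\<^sub>R y) = sqrt c * dist x y" if "c \<ge> 0"
      for c and x y :: "real^'n"
      using that by (simp add: dist_norm flip: scaleR_diff_right)
    then show "(a *\<^sub>R s + b *\<^sub>R t) $ Abs_edge (i, j) =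
      (dist (sqrt a *\<^sub>R v i, sqrt b *\<^sub>R w i) (sqrt a *\<^sub>R v j, sqrt b *\<^sub>R w j))\<^sup>2"
      using a b by (simp add: st dist_Pair_Pair power_mult_distrib)
  qed
qed

theorem theorem3p5:
  shows "pos_convex_cone (simplex_sq_lengths :: (real^('n::finite edge)) set)"
  unfolding pos_convex_cone_def
proof (intro conjI ballI allI impI)
  show "convex (simplex_sq_lengths :: (real^('n edge)) set)"
  proof (rule convexI)
    fix s t :: "real^('n edge)" and a b :: real
    assume st: "s \<in> simplex_sq_lengths" "t \<in> simplex_sq_lengths"
      and ab: "0 \<le> a" "0 \<le> b" "a + b = 1"
    show "a *\<^sub>R s + b *\<^sub>R t \<in> simplex_sq_lengths"
    proof (cases "a = 0")
      case True
      then show ?thesis using st ab by simp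
    next
      case False
      then show ?thesis using st ab by (intro simplex_sq_lengths_combination) auto
    qed
  qed
next
  fix s :: "real^('n edge)" and c :: real
  assume "s \<in> simplex_sq_lengths" "c > 0"
  then show "c *\<^sub>R s \<in> simplex_sq_lengths"
    using simplex_sq_lengths_combination[of s s c 0] by simp
qed

end
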